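(* For every positive integer $k$ there exists a finite tree $T'_{(k)}$ such that $\gamma_t(T'_{(k)})-\tau(T'_{(k)})=k$.
   Context: A vertex cover of a graph $G=(V,E)$ is a set $X\subseteq V$ such that each edge is incident to at least one vertex of $X$; $\tau(G)$ is the minimum cardinality of a vertex cover of $G$. A total dominating set of $G$ is a dominating set $D\subseteq V$ such that the subgraph induced by $D$ has no isolated vertices (equivalently, every vertex of $G$ has a neighbor in $D$); $\gamma_t(G)$ is the minimum cardinality of a total dominating set of $G$ (defined for graphs without isolated vertices). *)

theory Defs
  imports "Graph_Theory.Graph_Theory"
begin

text \<open>
  A finite simple undirected graph is a \<^locale>\<open>graph\<close>: a finite, loop-free, symmetric digraph
  without parallel arcs, each undirected edge being a pair of opposite arcs. The definitions below
  read arcs as undirected edges and are meant for such digraphs.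
\<close>

text \<open>
  The library's \<^const>\<open>forest\<close> and \<^const>\<open>tree\<close> forbid all directed cycles, so in a symmetric
  digraph they already reject a single edge, because of the closed walk a, b, a. The cycles of the
  undirected graph are exactly the directed cycles with at least three arcs. The null graph is not
  \<^const>\<open>connected\<close>; the one-vertex graph is a tree.
\<close>

definition undirected_tree :: "('a,'b) pre_digraph \<Rightarrow> bool" where
  "undirected_tree G \<longleftrightarrow>
     graph G \<and> connected G \<and> \<not> (\<exists>p. pre_digraph.cycle G p \<and> 3 \<le> length p)"

definition vertex_cover :: "('a,'b) pre_digraph \<Rightarrow> 'a set \<Rightarrow> bool" where
  "vertex_cover G X \<longleftrightarrow> X \<subseteq> verts G \<and> (\<forall>e \<in> arcs G. tail G e \<in> X \<or> head G e \<in> X)"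

definition vertex_cover_number :: "('a,'b) pre_digraph \<Rightarrow> nat" (\<open>\<tau>\<close>) where
  "\<tau> G = Min (card ` {X. vertex_cover G X})"

definition no_isolated_vertices :: "('a,'b) pre_digraph \<Rightarrow> bool" where
  "no_isolated_vertices G \<longleftrightarrow> (\<forall>v \<in> verts G. \<exists>u \<in> verts G. v \<rightarrow>\<^bsub>G\<^esub> u)"

definition dominating_set :: "('a,'b) pre_digraph \<Rightarrow> 'a set \<Rightarrow> bool" where
  "dominating_set G D \<longleftrightarrow> D \<subseteq> verts G \<and> (\<forall>v \<in> verts G - D. \<exists>u \<in> D. v \<rightarrow>\<^bsub>G\<^esub> u)"

definition total_dominating_set :: "('a,'b) pre_digraph \<Rightarrow> 'a set \<Rightarrow> bool" where
  "total_dominating_set G D \<longleftrightarrow>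
     dominating_set G D \<and> no_isolated_vertices (G \<restriction> D)"

text \<open>
  Only meaningful for finite graphs without isolated vertices; otherwise the minimum may be taken
  over the empty set.
\<close>

definition total_domination_number :: "('a,'b) pre_digraph \<Rightarrow> nat" (\<open>\<gamma>\<^sub>t\<close>) where
  "\<gamma>\<^sub>t G = Min (card ` {D. total_dominating_set G D})"

end

theory Submission
  imports Defs
begin

text \<open>
  Attach \<open>m = k + 1\<close> legs of three vertices \<open>x\<^sub>i, a\<^sub>i, b\<^sub>i\<close> to a centre \<open>c\<close>, with \<open>x\<^sub>i\<close> adjacent to \<open>c\<close>.
  The edges \<open>a\<^sub>ib\<^sub>i\<close> together with one edge \<open>cx\<^sub>i\<close> form a matching and \<open>{c, a\<^sub>1, \<dots>, a\<^sub>m}\<close> is a vertex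
  cover, so \<open>\<tau> = m + 1\<close>. The neighbourhoods of the \<open>a\<^sub>i\<close> and \<open>b\<^sub>i\<close> are pairwise disjoint and all the
  \<open>x\<^sub>i\<close> and \<open>a\<^sub>i\<close> form a total dominating set, so \<open>\<gamma>\<^sub>t = 2 m\<close>.
\<close>

text \<open>Domination supplies neighbours for the vertices outside \<open>D\<close>, the absence of
  isolated vertices in the induced subgraph for those inside.\<close>

lemma total_dominating_set_iff:
  "total_dominating_set G D \<longleftrightarrow> D \<subseteq> verts G \<and> (\<forall>v \<in> verts G. \<exists>u \<in> D. v \<rightarrow>\<^bsub>G\<^esub> u)"
proof -
  have "v \<rightarrow>\<^bsub>G \<restriction> D\<^esub> u \<longleftrightarrow> v \<in> D \<and> u \<in> D \<and> v \<rightarrow>\<^bsub>G\<^esub> u" for u v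
    by (auto simp: arcs_ends_conv)
  then show ?thesis
    unfolding total_dominating_set_def dominating_set_def no_isolated_vertices_def by auto
qed

text \<open>The common scheme for \<open>\<tau>\<close> and \<open>\<gamma>\<^sub>t\<close>: a lower
  bound for all sets and one witness attaining it. The finite \<open>V\<close> bounds the
  candidates, so that \<open>Min\<close> is taken over a finite set.\<close>

lemma Min_card_eqI:
  assumes "finite V" and "\<And>X. P X \<Longrightarrow> X \<subseteq> V" and "\<And>X. P X \<Longrightarrow> n \<le> card X"
    and "P Y" and "card Y \<le> n"
  shows "Min (card ` {X. P X}) = n"
proof (rule Min_eqI)
  have "{X. P X} \<subseteq> Pow V" using assms(2) by auto
  then show "finite (card ` {X. P X})"
    using assms(1) finite_subset by blast
  show "n \<in> card ` {X. P X}"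
    using assms(3)[OF assms(4)] assms(4,5) by (auto intro!: image_eqI[of _ _ Y])
qed (use assms(3) in auto)

text \<open>A tree with root \<open>n\<close> once \<open>v < f v\<close> and
  \<open>f v \<le> n\<close> for all \<open>v < n\<close>. Taking endpoint pairs as arcs excludes
  parallel arcs; increasing labels exclude loops and make the climb to the root terminate.\<close>

definition parent_graph :: "nat \<Rightarrow> (nat \<Rightarrow> nat) \<Rightarrow> (nat, nat \<times> nat) pre_digraph" where
  "parent_graph n f = \<lparr>verts = {..n}, arcs = (\<Union>v<n. {(v, f v), (f v, v)}), tail = fst, head = snd\<rparr>"

lemma parent_graph_simps [simp]:
  "verts (parent_graph n f) = {..n}"
  "arcs (parent_graph n f) = (\<Union>v<n. {(v, f v), (f v, v)})"
  "tail (parent_graph n f) = fst"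
  "head (parent_graph n f) = snd"
  by (simp_all add: parent_graph_def)

lemma parent_graph_dominates_iff:
  "u \<rightarrow>\<^bsub>parent_graph n f\<^esub> v \<longleftrightarrow> (u < n \<and> v = f u) \<or> (v < n \<and> u = f v)"
  by (auto simp: arcs_ends_conv)

context
  fixes n :: nat and f :: "nat \<Rightarrow> nat"
  assumes parent_greater: "\<And>v. v < n \<Longrightarrow> v < f v" and parent_le: "\<And>v. v < n \<Longrightarrow> f v \<le> n"
begin

lemma graph_parent_graph: "graph (parent_graph n f)"
proof
  show "symmetric (parent_graph n f)"
    by (auto simp: symmetric_def sym_def parent_graph_dominates_iff)
next
  fix e assume "e \<in> arcs (parent_graph n f)"
  then obtain v where "v < n" "e = (v, f v) \<or> e = (f v, v)" by auto
  then show "tail (parent_graph n f) e \<in> verts (parent_graph n f)"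
    and "head (parent_graph n f) e \<in> verts (parent_graph n f)"
    and "tail (parent_graph n f) e \<noteq> head (parent_graph n f) e"
    using parent_greater[of v] parent_le[of v] by auto
qed (simp_all add: arc_to_ends_def)

lemma connected_parent_graph: "connected (parent_graph n f)"
proof -
  let ?G = "parent_graph n f"
  interpret graph ?G by (rule graph_parent_graph)
  have to_root: "v \<rightarrow>\<^sup>*\<^bsub>?G\<^esub> n" if "v \<le> n" for v
    using that
  proof (induction "n - v" arbitrary: v rule: less_induct)
    case less
    show ?case
    proof (cases "v = n")
      case True
      then show ?thesis by simp
    next
      case False
      then have "v < n" using less.prems by simp
      then have "v \<rightarrow>\<^bsub>?G\<^esub> f v" by (simp add: parent_graph_dominates_iff)
      moreover have "f v \<rightarrow>\<^sup>*\<^bsub>?G\<^esub> n"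
        using less.hyps[of "f v"] parent_greater parent_le \<open>v < n\<close> by (simp add: diff_less_mono2)
      ultimately show ?thesis by (rule adj_reachable_trans)
    qed
  qed
  have "u \<rightarrow>\<^sup>*\<^bsub>?G\<^esub> v" if "u \<le> n" "v \<le> n" for u v
    using to_root[OF that(1)] symmetric_reachable[OF sym_arcs to_root[OF that(2)]]
    by (rule reachable_trans)
  then have "u \<rightarrow>\<^sup>*\<^bsub>mk_symmetric ?G\<^esub> v" if "u \<le> n" "v \<le> n" for u v
    using that by (intro reachable_mk_symmetricI)
  then show ?thesis
    unfolding connected_def by (intro strongly_connectedI) auto
qed

text \<open>Both neighbours of the smallest vertex of a cycle are larger, hence equal to its parent.\<close>

lemma parent_graph_cycle_length:
  assumes "pre_digraph.cycle (parent_graph n f) p"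
  shows "length p \<le> 2"
proof (rule ccontr)
  let ?G = "parent_graph n f"
  interpret graph ?G by (rule graph_parent_graph)
  define l where "l = length p"
  assume "\<not> length p \<le> 2"
  then have l: "3 \<le> l" by (simp add: l_def)
  obtain u where walk: "awalk u p u" and dist: "distinct (tl (awalk_verts u p))" and "p \<noteq> []"
    using assms unfolding cycle_def by blast
  have cas: "cas u p u" and arcs: "set p \<subseteq> arcs ?G" using walk by (auto simp: awalk_def)
  have "distinct (map snd p)"
    using dist awalk_verts_conv'[OF cas] \<open>p \<noteq> []\<close> by simp
  then have inj: "i = j" if "snd (p ! i) = snd (p ! j)" "i < l" "j < l" for i j
    using that by (simp add: distinct_conv_nth l_def) metis
  \<comment> \<open>The vertex sequence of the walk, read off once from tails and once from heads;
    comparing entries links consecutive arcs.\<close>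
  have eq: "map fst p @ [snd (last p)] = fst (hd p) # map snd p"
    using awalk_verts_conv[of u p] awalk_verts_conv'[OF cas] \<open>p \<noteq> []\<close> by simp
  have "fst (hd p) = u" using cas \<open>p \<noteq> []\<close> by (cases p) auto
  moreover have "snd (last p) = u"
    using awlast_if_cas[OF cas] \<open>p \<noteq> []\<close> by (simp add: awalk_verts_conv)
  ultimately have wrap: "fst (p ! 0) = snd (p ! (l - 1))"
    using \<open>p \<noteq> []\<close> by (simp add: hd_conv_nth last_conv_nth l_def)
  have step: "fst (p ! Suc i) = snd (p ! i)" if "Suc i < l" for i
    using arg_cong[OF eq, of "\<lambda>xs. xs ! Suc i"] that by (simp add: nth_append l_def)
  have "finite (set p)" "set p \<noteq> {}" using \<open>p \<noteq> []\<close> by auto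
  \<comment> \<open>Every vertex of the cycle is the head of one of its arcs, so the smallest head
    is the smallest vertex.\<close>
  then obtain e where e: "e \<in> set p" "\<And>e'. e' \<in> set p \<Longrightarrow> snd e \<le> snd e'"
    using ex_min_if_finite[of "snd ` set p"] by (auto simp: not_less)
  then obtain i where i: "i < l" "e = p ! i" by (auto simp: in_set_conv_nth l_def)
  define v where "v = snd (p ! i)"
  have min: "v \<le> snd (p ! j)" if "j < l" for j
    using e i that by (simp add: v_def l_def)
  \<comment> \<open>A larger neighbour \<open>w\<close> cannot be a child of \<open>v\<close>, since
    \<open>v\<close> would then be its larger parent.\<close>
  have nbr: "w = f v" if "(w, v) \<in> arcs ?G \<or> (v, w) \<in> arcs ?G" "v \<le> w" for w
    using that parent_greater by fastforce
  \<comment> \<open>Cyclic predecessor and successor of \<open>i\<close>. The heads of these arcs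
    are the two neighbours of \<open>v\<close> on the cycle; the indices differ because
    \<open>3 \<le> l\<close>, and would coincide for \<open>l = 2\<close>.\<close>
  define pr where "pr = (if i = 0 then l - 1 else i - 1)"
  define nx where "nx = (if i = l - 1 then 0 else Suc i)"
  have bounds: "pr < l" "nx < l" and "pr \<noteq> nx"
    using i l by (auto simp: pr_def nx_def)
  have pr: "fst (p ! i) = snd (p ! pr)" using wrap step[of "i - 1"] i by (auto simp: pr_def)
  have nx: "fst (p ! nx) = snd (p ! i)" using wrap step[of i] i by (auto simp: nx_def)
  have arc: "p ! j \<in> arcs ?G" if "j < l" for j using arcs that nth_mem unfolding l_def by blast
  have "(snd (p ! pr), v) \<in> arcs ?G"
    using arc[OF i(1)] pr by (metis prod.collapse v_def)
  moreover have "(v, snd (p ! nx)) \<in> arcs ?G"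
    using arc[OF bounds(2)] nx by (metis prod.collapse v_def)
  ultimately have "snd (p ! pr) = f v" "snd (p ! nx) = f v"
    using nbr min bounds by blast+
  then show False using inj bounds \<open>pr \<noteq> nx\<close> by metis
qed

lemma undirected_tree_parent_graph: "undirected_tree (parent_graph n f)"
proof -
  have "\<not> 3 \<le> length p" if "pre_digraph.cycle (parent_graph n f) p" for p
    using parent_graph_cycle_length[OF that] by simp
  then show ?thesis
    unfolding undirected_tree_def using graph_parent_graph connected_parent_graph by blast
qed

end

text \<open>The centre is \<open>3 * m\<close>, and \<open>b\<^sub>i, a\<^sub>i, x\<^sub>i\<close> are \<open>3 * i\<close>, \<open>3 * i + 1\<close>, \<open>3 * i + 2\<close> for \<open>i < m\<close>.\<close>

definition spider :: "nat \<Rightarrow> (nat, nat \<times> nat) pre_digraph" where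
  "spider m = parent_graph (3 * m) (\<lambda>v. if v mod 3 = 2 then 3 * m else Suc v)"

lemma verts_spider [simp]: "verts (spider m) = {..3 * m}"
  by (simp add: spider_def)

lemma spider_dominates_iff:
  "u \<rightarrow>\<^bsub>spider m\<^esub> v \<longleftrightarrow>
    (u < 3 * m \<and> v = (if u mod 3 = 2 then 3 * m else Suc u)) \<or>
    (v < 3 * m \<and> u = (if v mod 3 = 2 then 3 * m else Suc v))"
  unfolding spider_def by (rule parent_graph_dominates_iff)

lemma undirected_tree_spider: "undirected_tree (spider m)"
  unfolding spider_def by (rule undirected_tree_parent_graph) auto

lemma spider_vertex_cases:
  assumes "v \<le> 3 * (m::nat)"
  obtains "v = 3 * m"
  | i where "i < m" "v = 3 * i"
  | i where "i < m" "v = 3 * i + 1"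
  | i where "i < m" "v = 3 * i + 2"
proof -
  consider "v = 3 * m" | "v < 3 * m" using assms by linarith
  then show thesis
  proof cases
    case 2
    then have "v div 3 < m" by (simp add: less_mult_imp_div_less mult.commute)
    moreover have "v = 3 * (v div 3) \<or> v = 3 * (v div 3) + 1 \<or> v = 3 * (v div 3) + 2" by presburger
    ultimately show ?thesis using that by blast
  qed (rule that)
qed

text \<open>Each non-central \<open>v\<close> stands for the edge to its parent; the two opposite
  arcs impose the same condition.\<close>

lemma vertex_cover_spider_iff:
  "vertex_cover (spider m) X \<longleftrightarrow>
    X \<subseteq> {..3 * m} \<and> (\<forall>v<3 * m. v \<in> X \<or> (if v mod 3 = 2 then 3 * m else Suc v) \<in> X)"
proof -
  have "(\<forall>e \<in> arcs (spider m). tail (spider m) e \<in> X \<or> head (spider m) e \<in> X) \<longleftrightarrow>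
    (\<forall>v<3 * m. v \<in> X \<or> (if v mod 3 = 2 then 3 * m else Suc v) \<in> X)"
    unfolding spider_def parent_graph_simps ball_UN by auto
  then show ?thesis by (simp only: vertex_cover_def verts_spider)
qed

lemma vertex_cover_number_spider:
  assumes "m \<ge> 1"
  shows "\<tau> (spider m) = m + 1"
  unfolding vertex_cover_number_def
proof (rule Min_card_eqI)
  show "finite {..3 * m}" by simp
  show "X \<subseteq> {..3 * m}" if "vertex_cover (spider m) X" for X
    using that by (simp add: vertex_cover_spider_iff)
  show "m + 1 \<le> card X" if "vertex_cover (spider m) X" for X
  proof -
    have X: "X \<subseteq> {..3 * m}"
      and cover: "\<And>v. v < 3 * m \<Longrightarrow> v \<in> X \<or> (if v mod 3 = 2 then 3 * m else Suc v) \<in> X"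
      using that by (auto simp: vertex_cover_spider_iff)
    \<comment> \<open>The label \<open>v \<mapsto> (v + 1) div 3\<close> separates the edges \<open>b\<^sub>ia\<^sub>i\<close> and the last \<open>x\<^sub>ic\<close> from each other.\<close>
    have "{..m} \<subseteq> (\<lambda>v. (v + 1) div 3) ` X"
    proof
      fix i assume "i \<in> {..m}"
      show "i \<in> (\<lambda>v. (v + 1) div 3) ` X"
      proof (cases "i = m")
        case True
        obtain j where m: "m = Suc j" using assms by (cases m) auto
        have "3 * j + 2 \<in> X \<or> 3 * m \<in> X" using cover[of "3 * j + 2"] by (simp add: m mod_Suc)
        moreover have "(3 * j + 2 + 1) div 3 = i" "(3 * m + 1) div 3 = i" using True m by simp_all
        ultimately show ?thesis by (metis imageI)
      next
        case False
        then have "3 * i \<in> X \<or> 3 * i + 1 \<in> X" using cover[of "3 * i"] \<open>i \<in> {..m}\<close> by simp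
        then show ?thesis by (auto intro: rev_image_eqI)
      qed
    qed
    moreover have "finite X" using X finite_subset by blast
    ultimately show ?thesis using surj_card_le by fastforce
  qed
  let ?Y = "insert (3 * m) ((\<lambda>i. 3 * i + 1) ` {..<m})"
  show "vertex_cover (spider m) ?Y"
    unfolding vertex_cover_spider_iff
  proof (intro conjI allI impI)
    fix v assume "v < 3 * m"
    then have "v \<le> 3 * m" by simp
    then show "v \<in> ?Y \<or> (if v mod 3 = 2 then 3 * m else Suc v) \<in> ?Y"
      by (cases rule: spider_vertex_cases) (auto simp: mod_Suc)
  qed auto
  show "card ?Y \<le> m + 1"
    using card_image_le[of "{..<m}" "\<lambda>i. 3 * i + 1"] card_insert_le_m1 by (simp add: card_insert_if)
qed

lemma total_dominating_set_spider:
  assumes "m \<ge> 1"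
  shows "total_dominating_set (spider m) ((\<lambda>i. 3 * i + 1) ` {..<m} \<union> (\<lambda>i. 3 * i + 2) ` {..<m})"
    (is "total_dominating_set _ ?D")
  unfolding total_dominating_set_iff
proof (intro conjI ballI)
  fix v assume "v \<in> verts (spider m)"
  then have "v \<le> 3 * m" by simp
  then show "\<exists>u\<in>?D. v \<rightarrow>\<^bsub>spider m\<^esub> u"
  proof (cases rule: spider_vertex_cases)
    case 1
    \<comment> \<open>The centre is dominated by the \<open>x\<close> of leg 0, which exists because
      \<open>m \<ge> 1\<close>.\<close>
    then have "v \<rightarrow>\<^bsub>spider m\<^esub> (3 * 0 + 2)" using assms by (simp add: spider_dominates_iff)
    then show ?thesis using assms by force
  next
    case (2 i)
    then have "v \<rightarrow>\<^bsub>spider m\<^esub> (3 * i + 1)" by (simp add: spider_dominates_iff)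
    then show ?thesis using 2 by blast
  next
    case (3 i)
    then have "v \<rightarrow>\<^bsub>spider m\<^esub> (3 * i + 2)" by (simp add: spider_dominates_iff mod_Suc)
    then show ?thesis using 3 by blast
  next
    case (4 i)
    then have "v \<rightarrow>\<^bsub>spider m\<^esub> (3 * i + 1)" by (simp add: spider_dominates_iff mod_Suc)
    then show ?thesis using 4 by blast
  qed
qed auto

lemma total_domination_number_spider:
  assumes "m \<ge> 1"
  shows "\<gamma>\<^sub>t (spider m) = 2 * m"
  unfolding total_domination_number_def
proof (rule Min_card_eqI)
  show "finite {..3 * m}" by simp
  show "D \<subseteq> {..3 * m}" if "total_dominating_set (spider m) D" for D
    using that by (simp add: total_dominating_set_iff)
  show "2 * m \<le> card D" if "total_dominating_set (spider m) D" for D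
  proof -
    have D: "D \<subseteq> {..3 * m}" and dom: "\<And>v. v \<le> 3 * m \<Longrightarrow> \<exists>u\<in>D. v \<rightarrow>\<^bsub>spider m\<^esub> u"
      using that by (auto simp: total_dominating_set_iff)
    \<comment> \<open>The labels \<open>(i, True)\<close> and \<open>(i, False)\<close> separate the neighbourhoods of \<open>b\<^sub>i\<close> and \<open>a\<^sub>i\<close>.\<close>
    have "{..<m} \<times> UNIV \<subseteq> (\<lambda>v. (v div 3, v mod 3 = 1)) ` D"
    proof clarify
      fix i c assume "i < m"
      show "(i, c) \<in> (\<lambda>v. (v div 3, v mod 3 = 1)) ` D"
      proof (cases c)
        case True
        obtain u where "u \<in> D" "(3 * i) \<rightarrow>\<^bsub>spider m\<^esub> u" using dom[of "3 * i"] \<open>i < m\<close> by auto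
        \<comment> \<open>\<open>3 * i\<close> is a leaf: its predecessor in the numbering has
          residue 2 and hence the centre as parent.\<close>
        moreover from this(2) have "u = 3 * i + 1"
          unfolding spider_dominates_iff using \<open>i < m\<close> by (auto split: if_splits) presburger
        ultimately show ?thesis using True by (auto intro: rev_image_eqI)
      next
        case False
        obtain u where "u \<in> D" "(3 * i + 1) \<rightarrow>\<^bsub>spider m\<^esub> u" using dom[of "3 * i + 1"] \<open>i < m\<close> by auto
        moreover from this(2) have "u = 3 * i \<or> u = 3 * i + 2"
          unfolding spider_dominates_iff using \<open>i < m\<close>
          by (auto simp: mod_Suc split: if_splits)
        ultimately show ?thesis using False by (auto simp: mod_Suc intro: rev_image_eqI)
      qed
    qed
    moreover have "finite D" using D finite_subset by blast
    ultimately have "card ({..<m} \<times> (UNIV :: bool set)) \<le> card D" by (rule surj_card_le[rotated])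
    then show ?thesis by (simp add: card_cartesian_product)
  qed
  let ?D = "(\<lambda>i. 3 * i + 1) ` {..<m} \<union> (\<lambda>i. 3 * i + 2) ` {..<m}"
  show "total_dominating_set (spider m) ?D"
    using assms by (rule total_dominating_set_spider)
  show "card ?D \<le> 2 * m"
    using card_Un_le[of "(\<lambda>i. 3 * i + 1) ` {..<m}" "(\<lambda>i. 3 * i + 2) ` {..<m}"]
      card_image_le[of "{..<m}" "\<lambda>i. 3 * i + 1"] card_image_le[of "{..<m}" "\<lambda>i. 3 * i + 2"]
    by simp
qed

theorem proposition2:
  fixes k :: nat
  assumes "k \<ge> 1"
  shows "\<exists>T :: (nat, nat \<times> nat) pre_digraph.
    undirected_tree T \<and> no_isolated_vertices T \<and> int (\<gamma>\<^sub>t T) - int (\<tau> T) = int k"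
proof (intro exI conjI)
  \<comment> \<open>With \<open>m = k + 1\<close> legs the difference is
    \<open>2 * m - (m + 1) = m - 1 = k\<close>.\<close>
  let ?T = "spider (k + 1)"
  show "undirected_tree ?T" by (rule undirected_tree_spider)
  \<comment> \<open>Any total dominating set gives every vertex a neighbour.\<close>
  obtain D where "total_dominating_set ?T D"
    using total_dominating_set_spider[of "k + 1"] by auto
  then show "no_isolated_vertices ?T"
    unfolding total_dominating_set_iff no_isolated_vertices_def by blast
  show "int (\<gamma>\<^sub>t ?T) - int (\<tau> ?T) = int k"
    by (simp add: vertex_cover_number_spider total_domination_number_spider)
qed

end
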